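(* Let $\sigma,n\ge2$ be integers with $\sigma\le n$. Any data structure supporting inverse suffix array queries for every text $T\in[0..\sigma)^n$ has worst-case space usage $\Omega(n\log\sigma)$ bits; that is, there is an absolute constant $\delta>0$ such that for all integers $2\le\sigma\le n$, any such data structure uses at least $\delta\,n\log\sigma$ bits on some $T\in[0..\sigma)^n$.
   Context: Here $[0..\sigma)=\{0,\dots,\sigma-1\}$ and $\log$ is base 2. For a text $T$ of length $n$, the suffix array $\mathrm{SA}_T[1..n]$ is the permutation of $\{1,\dots,n\}$ such that $T[\mathrm{SA}_T[1]..n]\prec\cdots\prec T[\mathrm{SA}_T[n]..n]$ lexicographically (a proper prefix of a string precedes that string), and $\mathrm{SA}^{-1}_T$ is the inverse permutation. An inverse suffix array query takes $j\in\{1,\dots,n\}$ and returns $\mathrm{SA}^{-1}_T[j]$. A data structure supporting a query problem for a family of inputs (with parameters $\sigma,n$ fixed) assigns to each input a finite bit string; the answer to every query on an input is determined by the stored bit string and the query arguments only. The space used on an input is the length of its bit string, and the worst-case space usage is the maximum over all inputs in the family. Query time is irrelevant. *)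

theory Defs
  imports Complex_Main "HOL-Combinatorics.Permutations"
begin

section \<open>Texts and suffix arrays\<close>

definition texts :: "nat \<Rightarrow> nat \<Rightarrow> nat list set" where
  "texts \<sigma> n = {T. length T = n \<and> set T \<subseteq> {0..<\<sigma>}}"

text \<open>Text positions are 1-based: the suffix \<open>T[i..n]\<close> is only used for \<open>1 \<le> i \<le> n\<close>.\<close>

definition suffix_at :: "nat list \<Rightarrow> nat \<Rightarrow> nat list" where
  "suffix_at T i = drop (i - 1) T"

text \<open>For \<^const>\<open>lexord\<close>, a proper prefix of a list precedes that list.\<close>

definition lex_less :: "nat list \<Rightarrow> nat list \<Rightarrow> bool" where
  "lex_less u v \<longleftrightarrow> (u, v) \<in> lexord less_than"

text \<open>A predicate \<open>p permutes A\<close> includes that \<open>p\<close> is the identity outside \<open>A\<close>, so the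
  suffix array is unique as a total function.\<close>

definition is_suffix_array :: "nat list \<Rightarrow> (nat \<Rightarrow> nat) \<Rightarrow> bool" where
  "is_suffix_array T p \<longleftrightarrow>
     p permutes {1..length T} \<and>
     (\<forall>i\<in>{1..length T}. \<forall>j\<in>{1..length T}.
        i < j \<longrightarrow> lex_less (suffix_at T (p i)) (suffix_at T (p j)))"

definition suffix_array :: "nat list \<Rightarrow> nat \<Rightarrow> nat" where
  "suffix_array T = (THE p. is_suffix_array T p)"

definition inverse_suffix_array :: "nat list \<Rightarrow> nat \<Rightarrow> nat" where
  "inverse_suffix_array T = inv (suffix_array T)"

lemma lex_less_irrefl: "\<not> lex_less u u"
  unfolding lex_less_def by (rule lexord_irreflexive) auto

lemma lex_less_trans: "lex_less u v \<Longrightarrow> lex_less v w \<Longrightarrow> lex_less u w"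
  unfolding lex_less_def by (rule lexord_trans) auto

lemma lex_less_linear: "lex_less u v \<or> u = v \<or> lex_less v u"
  unfolding lex_less_def by (rule lexord_linear) auto

lemma suffix_at_inj:
  assumes "i \<in> {1..length T}" "j \<in> {1..length T}" "suffix_at T i = suffix_at T j"
  shows "i = j"
proof -
  have "length (suffix_at T i) = length (suffix_at T j)" using assms by simp
  then show ?thesis using assms unfolding suffix_at_def by auto
qed

definition suffix_rank :: "nat list \<Rightarrow> nat \<Rightarrow> nat" where
  "suffix_rank T i =
     Suc (card {j \<in> {1..length T}. lex_less (suffix_at T j) (suffix_at T i)})"

lemma suffix_rank_less:
  assumes "i \<in> {1..length T}" "lex_less (suffix_at T i) (suffix_at T j)"
  shows "suffix_rank T i < suffix_rank T j"
proof -
  have "{k \<in> {1..length T}. lex_less (suffix_at T k) (suffix_at T i)}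
      \<subset> {k \<in> {1..length T}. lex_less (suffix_at T k) (suffix_at T j)}"
    using assms lex_less_trans lex_less_irrefl by blast
  then show ?thesis unfolding suffix_rank_def by (simp add: psubset_card_mono)
qed

lemma suffix_rank_bij: "bij_betw (suffix_rank T) {1..length T} {1..length T}"
proof -
  have inj: "inj_on (suffix_rank T) {1..length T}"
  proof (rule inj_onI)
    fix i j assume a: "i \<in> {1..length T}" "j \<in> {1..length T}"
      "suffix_rank T i = suffix_rank T j"
    show "i = j"
      using lex_less_linear[of "suffix_at T i" "suffix_at T j"] a
        suffix_rank_less[of i T j] suffix_rank_less[of j T i] suffix_at_inj[of i T j]
      by auto
  qed
  have sub: "suffix_rank T ` {1..length T} \<subseteq> {1..length T}"
  proof
    fix r assume "r \<in> suffix_rank T ` {1..length T}"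
    then obtain i where i: "i \<in> {1..length T}" "r = suffix_rank T i" by auto
    have "{j \<in> {1..length T}. lex_less (suffix_at T j) (suffix_at T i)} \<subset> {1..length T}"
      using i lex_less_irrefl by blast
    then have "card {j \<in> {1..length T}. lex_less (suffix_at T j) (suffix_at T i)}
        < card {1..length T}"
      by (intro psubset_card_mono) auto
    then show "r \<in> {1..length T}" using i unfolding suffix_rank_def by simp
  qed
  show ?thesis
    unfolding bij_betw_def using inj sub endo_inj_surj[of "{1..length T}"] by blast
qed

lemma suffix_rank_suffix_array:
  assumes p: "is_suffix_array T p" and k: "k \<in> {1..length T}"
  shows "suffix_rank T (p k) = k"
proof -
  have perm: "p permutes {1..length T}"
    and ord: "\<And>i j. i \<in> {1..length T} \<Longrightarrow> j \<in> {1..length T} \<Longrightarrow> i < j \<Longrightarrow>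
        lex_less (suffix_at T (p i)) (suffix_at T (p j))"
    using p unfolding is_suffix_array_def by auto
  have "{j \<in> {1..length T}. lex_less (suffix_at T j) (suffix_at T (p k))} = p ` {1..<k}"
  proof (intro set_eqI iffI)
    fix j assume j: "j \<in> {j \<in> {1..length T}. lex_less (suffix_at T j) (suffix_at T (p k))}"
    then obtain i where i: "i \<in> {1..length T}" "j = p i"
      using permutes_image[OF perm] by blast
    have "\<not> k \<le> i"
      using j i ord[OF k i(1)] lex_less_trans lex_less_irrefl
      by (metis (no_types, lifting) le_neq_implies_less mem_Collect_eq)
    then show "j \<in> p ` {1..<k}" using i by auto
  next
    fix j assume "j \<in> p ` {1..<k}"
    then obtain i where i: "i \<in> {1..<k}" "j = p i" by auto
    then have "i \<in> {1..length T}" using k by auto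
    then show "j \<in> {j \<in> {1..length T}. lex_less (suffix_at T j) (suffix_at T (p k))}"
      using ord[of i k] k i permutes_in_image[OF perm, of i] by simp
  qed
  moreover have "card (p ` {1..<k}) = k - 1"
    using card_image[of p "{1..<k}"] permutes_inj_on[OF perm] by simp
  ultimately show ?thesis using k unfolding suffix_rank_def by simp
qed

lemma is_suffix_array_ex1: "\<exists>!p. is_suffix_array T p"
proof (rule ex_ex1I)
  define r where "r i = (if i \<in> {1..length T} then suffix_rank T i else i)" for i
  have "bij_betw r {1..length T} {1..length T}"
    using suffix_rank_bij[of T] bij_betw_cong[of "{1..length T}" r "suffix_rank T"]
    by (simp add: r_def)
  then have r: "r permutes {1..length T}"
    by (rule bij_imp_permutes) (auto simp: r_def)
  have "lex_less (suffix_at T (inv r i)) (suffix_at T (inv r j))"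
    if ij: "i \<in> {1..length T}" "j \<in> {1..length T}" "i < j" for i j
  proof -
    have mem: "inv r i \<in> {1..length T}" "inv r j \<in> {1..length T}"
      using ij permutes_in_image[OF permutes_inv[OF r]] by blast+
    have eq: "r (inv r i) = i" "r (inv r j) = j"
      using permutes_inverses(1)[OF r] by auto
    then have lt: "suffix_rank T (inv r i) < suffix_rank T (inv r j)"
      using mem ij(3) by (simp add: r_def)
    show ?thesis
      using lex_less_linear[of "suffix_at T (inv r i)" "suffix_at T (inv r j)"] lt
        suffix_rank_less[OF mem(2), of "inv r i"] suffix_at_inj[OF mem] by fastforce
  qed
  then have "is_suffix_array T (inv r)"
    unfolding is_suffix_array_def using permutes_inv[OF r] by blast
  then show "\<exists>p. is_suffix_array T p" by (intro exI[of _ "inv r"])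
next
  fix p q assume p: "is_suffix_array T p" and q: "is_suffix_array T q"
  have perm: "p permutes {1..length T}" "q permutes {1..length T}"
    using p q unfolding is_suffix_array_def by auto
  show "p = q"
  proof
    fix k show "p k = q k"
    proof (cases "k \<in> {1..length T}")
      case True
      then have "suffix_rank T (p k) = suffix_rank T (q k)"
        using suffix_rank_suffix_array p q by simp
      moreover have "p k \<in> {1..length T}" "q k \<in> {1..length T}"
        using True permutes_in_image[OF perm(1)] permutes_in_image[OF perm(2)] by blast+
      ultimately show ?thesis
        using inj_onD[OF bij_betw_imp_inj_on[OF suffix_rank_bij[of T]]] by blast
    next
      case False
      then show ?thesis
        using permutes_not_in[OF perm(1) False] permutes_not_in[OF perm(2) False] by simp
    qed
  qed
qed

lemma is_suffix_array_suffix_array: "is_suffix_array T (suffix_array T)"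
  unfolding suffix_array_def using theI'[OF is_suffix_array_ex1] .


section \<open>Data structures\<close>

text \<open>The input family \<open>X\<close>, the query arguments \<open>Q\<close> and the answers \<open>f\<close> make up the query
  problem. A data structure stores the bit string \<open>enc x\<close> for the input \<open>x\<close>; \<open>ans\<close> sees only
  that bit string and the query argument.\<close>

definition data_structure ::
  "'x set \<Rightarrow> 'q set \<Rightarrow> ('x \<Rightarrow> 'q \<Rightarrow> 'a) \<Rightarrow> ('x \<Rightarrow> bool list) \<Rightarrow> (bool list \<Rightarrow> 'q \<Rightarrow> 'a) \<Rightarrow> bool"
  where
  "data_structure X Q f enc ans \<longleftrightarrow> (\<forall>x\<in>X. \<forall>q\<in>Q. ans (enc x) q = f x q)"

definition worst_case_space :: "'x set \<Rightarrow> ('x \<Rightarrow> bool list) \<Rightarrow> nat" where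
  "worst_case_space X enc = Max ((\<lambda>x. length (enc x)) ` X)"

lemma finite_texts: "finite (texts \<sigma> n)"
  using finite_lists_length_eq[of "{0..<\<sigma>}" n] by (simp add: texts_def conj_commute)

lemma texts_nonempty: "\<sigma> > 0 \<Longrightarrow> texts \<sigma> n \<noteq> {}"
proof -
  assume "\<sigma> > 0"
  then have "replicate n 0 \<in> texts \<sigma> n" by (auto simp: texts_def)
  then show ?thesis by blast
qed

lemma le_worst_case_space_texts:
  assumes "\<sigma> > 0"
  shows "c \<le> real (worst_case_space (texts \<sigma> n) enc) \<longleftrightarrow>
    (\<exists>T\<in>texts \<sigma> n. c \<le> real (length (enc T)))"
proof
  have fin: "finite ((\<lambda>x. length (enc x)) ` texts \<sigma> n)" by (simp add: finite_texts)
  have "worst_case_space (texts \<sigma> n) enc \<in> (\<lambda>x. length (enc x)) ` texts \<sigma> n"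
    unfolding worst_case_space_def using fin texts_nonempty[OF assms] by (intro Max_in) auto
  then show "\<exists>T\<in>texts \<sigma> n. c \<le> real (length (enc T))"
    if "c \<le> real (worst_case_space (texts \<sigma> n) enc)" using that by auto
  show "c \<le> real (worst_case_space (texts \<sigma> n) enc)"
    if ex: "\<exists>T\<in>texts \<sigma> n. c \<le> real (length (enc T))"
  proof -
    obtain T where T: "T \<in> texts \<sigma> n" "c \<le> real (length (enc T))" using ex by blast
    have "length (enc T) \<le> worst_case_space (texts \<sigma> n) enc"
      unfolding worst_case_space_def using fin T(1) by (intro Max_ge) auto
    then show ?thesis using T(2) by linarith
  qed
qed

end

theory Submission
  imports Defs "HOL-Combinatorics.Multiset_Permutations"
begin

text \<open>
  Reading a text in suffix array order yields its symbols in sorted order. Hence among texts with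
  the same symbol multiset the suffix array determines the text. Concatenating \<open>n div \<sigma>\<close>
  permutations of the alphabet and padding with zeros gives \<open>(\<sigma>!) ^ (n div \<sigma>)\<close> such texts; since
  \<open>(\<sigma>!)\<^sup>2 \<ge> \<sigma> ^ \<sigma>\<close> and \<open>n \<le> 2 * \<sigma> * (n div \<sigma>)\<close>, this is at least \<open>\<sigma> powr (n / 4)\<close>. The encodings
  of these texts are pairwise distinct, so one of them is long.
\<close>

lemma sum_power2_less: "(\<Sum>i\<le>n. 2 ^ i) < (2 :: nat) ^ Suc n"
  by (induction n) simp_all

text \<open>Answers depend only on the stored bits, so inputs told apart by some query need
  different bit strings. With worst-case space \<open>L\<close>, only the fewer than
  \<open>2 ^ Suc L\<close> strings of length at most \<open>L\<close> are available for
  \<open>Y\<close>.\<close>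

lemma card_less_worst_case_space:
  assumes ds: "data_structure X Q f enc ans" and "finite X" and Y: "Y \<subseteq> X"
    and sep: "\<And>x y. x \<in> Y \<Longrightarrow> y \<in> Y \<Longrightarrow> (\<And>q. q \<in> Q \<Longrightarrow> f x q = f y q) \<Longrightarrow> x = y"
  shows "card Y < 2 ^ Suc (worst_case_space X enc)"
proof -
  let ?L = "worst_case_space X enc"
  let ?B = "{bs :: bool list. set bs \<subseteq> UNIV \<and> length bs \<le> ?L}"
  have "inj_on enc Y"
  proof (rule inj_onI)
    fix x y assume xy: "x \<in> Y" "y \<in> Y" "enc x = enc y"
    then have "f x q = f y q" if "q \<in> Q" for q
      using ds Y that unfolding data_structure_def by (metis subsetD)
    then show "x = y" using sep xy by blast
  qed
  moreover have "enc ` Y \<subseteq> ?B"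
    using Y \<open>finite X\<close> unfolding worst_case_space_def by (auto intro!: Max_ge)
  moreover have "finite ?B" by (rule finite_lists_length_le) simp
  ultimately have "card Y \<le> card ?B" by (rule card_inj_on_le)
  also have "\<dots> = (\<Sum>i\<le>?L. 2 ^ i)"
    by (subst card_lists_length_le) (simp_all add: card_UNIV_bool)
  also have "\<dots> < 2 ^ Suc ?L"
    by (rule sum_power2_less)
  finally show ?thesis .
qed

lemma lex_less_imp_hd_le:
  assumes "lex_less u v" "u \<noteq> []" "v \<noteq> []"
  shows "hd u \<le> hd v"
  using assms by (cases u; cases v) (auto simp: lex_less_def)

text \<open>Lexicographically increasing suffixes have non-decreasing first symbols, and a
  permutation of the positions meets every symbol with its multiplicity. The \<open>- 1\<close>
  turns a 1-based text position into an index for \<open>!\<close>.\<close>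

lemma map_suffix_array_eq_sort:
  assumes "is_suffix_array T p"
  shows "map (\<lambda>i. T ! (p i - 1)) [1..<Suc (length T)] = sort T"
proof (rule properties_for_sort[symmetric])
  have perm: "p permutes {1..length T}"
    and ord: "\<And>i j. i \<in> {1..length T} \<Longrightarrow> j \<in> {1..length T} \<Longrightarrow> i < j \<Longrightarrow>
        lex_less (suffix_at T (p i)) (suffix_at T (p j))"
    using assms unfolding is_suffix_array_def by auto
  have hd: "suffix_at T i \<noteq> []" "hd (suffix_at T i) = T ! (i - 1)" if "i \<in> {1..length T}" for i
    using that by (auto simp: suffix_at_def hd_drop_conv_nth)
  have le: "T ! (p i - 1) \<le> T ! (p j - 1)"
    if "i \<in> {1..length T}" "j \<in> {1..length T}" "i < j" for i j
  proof -
    have "p i \<in> {1..length T}" "p j \<in> {1..length T}"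
      using that permutes_in_image[OF perm] by blast+
    then show ?thesis using lex_less_imp_hd_le[OF ord[OF that]] hd by metis
  qed
  show "sorted (map (\<lambda>i. T ! (p i - 1)) [1..<Suc (length T)])"
    using le by (auto simp: sorted_iff_nth_mono_less simp del: upt_Suc)
  \<comment> \<open>The multiset of positions is invariant under \<open>p\<close>; looking up
    symbols on both sides carries this over to \<open>T\<close>. Writing positions as
    \<open>Suc\<close> of indices cancels the \<open>- 1\<close> of the lookup.\<close>
  have "image_mset p (mset_set {1..length T}) = mset_set {1..length T}"
    using perm by (simp add: image_mset_mset_set permutes_inj_on permutes_image)
  moreover have eq: "[1..<Suc (length T)] = map Suc [0..<length T]"
    by (simp add: map_Suc_upt)
  moreover have "mset [1..<Suc (length T)] = mset_set {1..length T}"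
    by (metis atLeastLessThanSuc_atLeastAtMost mset_upt)
  ultimately have "mset (map p [1..<Suc (length T)]) = mset (map Suc [0..<length T])"
    by (metis mset_map)
  then have "image_mset (\<lambda>i. T ! (i - 1)) (mset (map p [1..<Suc (length T)])) =
      image_mset (\<lambda>i. T ! (i - 1)) (mset (map Suc [0..<length T]))"
    by (rule arg_cong)
  then have "mset (map (\<lambda>i. T ! (p i - 1)) [1..<Suc (length T)]) =
      mset (map ((!) T) [0..<length T])"
    by (simp add: image_mset.compositionality comp_def del: upt_Suc)
  then show "mset (map (\<lambda>i. T ! (p i - 1)) [1..<Suc (length T)]) = mset T"
    by (simp add: map_nth)
qed

text \<open>Both texts sort to the same list, and the common suffix array tells at which position
  each sorted symbol stands.\<close>

lemma mset_suffix_array_inj: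
  assumes "mset S = mset T" and eq: "suffix_array S = suffix_array T"
  shows "S = T"
proof (rule nth_equalityI)
  show len: "length S = length T" using assms(1) by (rule mset_eq_length)
  define p where "p = suffix_array T"
  have p: "is_suffix_array S p" "is_suffix_array T p"
    using is_suffix_array_suffix_array eq unfolding p_def by metis+
  have "sort S = sort T" using assms(1) by (metis properties_for_sort mset_sort sorted_sort)
  then have "map (\<lambda>i. S ! (p i - 1)) [1..<Suc (length T)] =
      map (\<lambda>i. T ! (p i - 1)) [1..<Suc (length T)]"
    using map_suffix_array_eq_sort[OF p(1)] map_suffix_array_eq_sort[OF p(2)] len by metis
  then have *: "S ! (p i - 1) = T ! (p i - 1)" if "i \<in> {1..length T}" for i
    using that by (auto simp del: upt_Suc)
  fix k assume "k < length S"
  \<comment> \<open>Surjectivity of \<open>p\<close>: every index \<open>k\<close> is some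
    \<open>p i - 1\<close>, so the agreement along \<open>p\<close> reaches the whole text.\<close>
  then have "Suc k \<in> p ` {1..length T}"
    using p(2) len permutes_image unfolding is_suffix_array_def by fastforce
  then obtain i where "i \<in> {1..length T}" "p i = Suc k" by auto
  then show "S ! k = T ! k" using *[of i] by simp
qed

text \<open>Outside \<open>{1..n}\<close> both inverses are the identity, so agreement on the
  queries is equality of functions, and inverting again recovers the suffix arrays.\<close>

lemma inverse_suffix_array_inj:
  assumes "length S = n" "length T = n"
    and q: "\<And>j. j \<in> {1..n} \<Longrightarrow> inverse_suffix_array S j = inverse_suffix_array T j"
  shows "suffix_array S = suffix_array T"
proof -
  have p: "suffix_array S permutes {1..n}" "suffix_array T permutes {1..n}"
    using is_suffix_array_suffix_array assms(1,2) unfolding is_suffix_array_def by metis+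
  have "inv (suffix_array S) = inv (suffix_array T)"
  proof
    fix j show "inv (suffix_array S) j = inv (suffix_array T) j"
      using q[of j] permutes_not_in[OF permutes_inv[OF p(1)], of j]
        permutes_not_in[OF permutes_inv[OF p(2)], of j]
      unfolding inverse_suffix_array_def by metis
  qed
  then show ?thesis using permutes_inv_inv[OF p(1)] permutes_inv_inv[OF p(2)] by metis
qed

definition block_texts :: "nat \<Rightarrow> nat \<Rightarrow> nat list set" where
  "block_texts \<sigma> n = (\<lambda>bs. concat bs @ replicate (n mod \<sigma>) 0) `
     {bs. set bs \<subseteq> permutations_of_set {0..<\<sigma>} \<and> length bs = n div \<sigma>}"

lemma mset_concat_permutations:
  assumes "set bs \<subseteq> permutations_of_set A"
  shows "mset (concat bs) = repeat_mset (length bs) (mset_set A)"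
  using assms by (induction bs) (auto simp: permutations_of_set_def mset_set_set[symmetric])

lemma mset_block_texts:
  "T \<in> block_texts \<sigma> n \<Longrightarrow>
    mset T = repeat_mset (n div \<sigma>) (mset_set {0..<\<sigma>}) + replicate_mset (n mod \<sigma>) 0"
  by (auto simp: block_texts_def mset_concat_permutations)

lemma block_texts_subset:
  assumes "\<sigma> > 0"
  shows "block_texts \<sigma> n \<subseteq> texts \<sigma> n"
proof
  fix T assume T: "T \<in> block_texts \<sigma> n"
  have "length T = n"
    using arg_cong[OF mset_block_texts[OF T], of size] by simp
  moreover have "set T \<subseteq> {0..<\<sigma>}"
    using T assms by (fastforce simp: block_texts_def permutations_of_set_def)
  ultimately show "T \<in> texts \<sigma> n" by (simp add: texts_def)
qed

lemma card_block_texts: "card (block_texts \<sigma> n) = fact \<sigma> ^ (n div \<sigma>)"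
proof -
  let ?B = "{bs. set bs \<subseteq> permutations_of_set {0..<\<sigma>} \<and> length bs = n div \<sigma>}"
  have "inj_on (\<lambda>bs. concat bs @ replicate (n mod \<sigma>) 0) ?B"
  proof (rule inj_onI)
    fix bs cs assume *: "bs \<in> ?B" "cs \<in> ?B"
      "concat bs @ replicate (n mod \<sigma>) 0 = concat cs @ replicate (n mod \<sigma>) 0"
    \<comment> \<open>All blocks have length \<open>\<sigma>\<close>, so the concatenation can be
      cut back into its blocks in only one way.\<close>
    then have "length x = length y" if "(x, y) \<in> set (zip bs cs)" for x y
      using set_zip_leftD[OF that] set_zip_rightD[OF that]
      by (auto simp: length_finite_permutations_of_set dest!: subsetD)
    then show "bs = cs" using * by (intro concat_injective) auto
  qed
  then show ?thesis
    unfolding block_texts_def by (simp add: card_image card_lists_length_eq)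
qed

text \<open>Pair each factor \<open>i\<close> of one factorial with \<open>n + 1 - i\<close> of the
  other: every such product is at least \<open>n\<close>.\<close>

lemma power_self_le_fact_power2: "n ^ n \<le> (fact n :: nat)\<^sup>2"
proof -
  have "n ^ n = (\<Prod>i=1..n. n)" by simp
  also have "\<dots> \<le> (\<Prod>i=1..n. i * (n + 1 - i))"
  proof (rule prod_mono)
    fix i assume "i \<in> {1..n}"
    \<comment> \<open>This removes the truncated subtraction: the claim becomes
      \<open>a + b + 1 \<le> (a + 1) * (b + 1)\<close>.\<close>
    then obtain a b where "i = Suc a" "n = Suc a + b"
      by (auto dest!: le_Suc_ex simp: Suc_le_eq gr0_conv_Suc)
    then show "0 \<le> n \<and> n \<le> i * (n + 1 - i)" by simp
  qed
  also have "\<dots> = (\<Prod>i=1..n. i) * (\<Prod>i=1..n. n + 1 - i)" by (rule prod.distrib)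
  also have "(\<Prod>i=1..n. n + 1 - i) = (\<Prod>i=1..n. i)"
    by (subst prod.atLeastAtMost_rev) (auto intro!: prod.cong)
  finally show ?thesis by (simp add: fact_prod power2_eq_square)
qed

theorem theorem5p7:
  shows "\<exists>\<delta>::real. \<delta> > 0 \<and>
    (\<forall>\<sigma> n :: nat. 2 \<le> \<sigma> \<and> \<sigma> \<le> n \<longrightarrow>
      (\<forall>(enc :: nat list \<Rightarrow> bool list) (ans :: bool list \<Rightarrow> nat \<Rightarrow> nat).
        data_structure (texts \<sigma> n) {1..n} inverse_suffix_array enc ans \<longrightarrow>
        real (worst_case_space (texts \<sigma> n) enc) \<ge> \<delta> * real n * log 2 (real \<sigma>)))"
proof (intro exI[of _ "1 / 8"] conjI allI impI)
  \<comment> \<open>The 8 is a product of three losses of a factor 2: rounding in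
    \<open>n div \<sigma>\<close>, squaring the factorial, and replacing \<open>Suc L\<close> by
    \<open>2 * L\<close>.\<close>
  fix \<sigma> n :: nat and enc :: "nat list \<Rightarrow> bool list" and ans :: "bool list \<Rightarrow> nat \<Rightarrow> nat"
  assume \<sigma>n: "2 \<le> \<sigma> \<and> \<sigma> \<le> n"
    and ds: "data_structure (texts \<sigma> n) {1..n} inverse_suffix_array enc ans"
  define L where "L = worst_case_space (texts \<sigma> n) enc"
  define k where "k = n div \<sigma>"
  have sub: "block_texts \<sigma> n \<subseteq> texts \<sigma> n" using \<sigma>n by (intro block_texts_subset) simp
  have "card (block_texts \<sigma> n) < 2 ^ Suc L"
    unfolding L_def
  proof (rule card_less_worst_case_space[OF ds finite_texts sub])
    fix S T assume *: "S \<in> block_texts \<sigma> n" "T \<in> block_texts \<sigma> n"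
      "\<And>q. q \<in> {1..n} \<Longrightarrow> inverse_suffix_array S q = inverse_suffix_array T q"
    have "length S = n" "length T = n" using * sub by (auto simp: texts_def)
    then show "S = T"
      using * by (intro mset_suffix_array_inj inverse_suffix_array_inj)
        (simp_all add: mset_block_texts)
  qed
  then have N: "fact \<sigma> ^ k < (2 :: nat) ^ Suc L" by (simp add: card_block_texts k_def)
  have k: "k \<ge> 1" using \<sigma>n by (simp add: k_def div_greater_zero_iff Suc_le_eq)
  \<comment> \<open>There are at least two block texts, which rules out \<open>L = 0\<close>; hence
    \<open>Suc L \<le> 2 * L\<close> later on.\<close>
  have "2 \<le> (fact \<sigma> :: nat)" using fact_mono_nat[of 2 \<sigma>] \<sigma>n by simp
  also have "\<dots> \<le> fact \<sigma> ^ k" using k by (intro self_le_power) auto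
  finally have "L \<noteq> 0" using N by (cases L) auto
  \<comment> \<open>The padding is shorter than one block and there is at least one block, so the
    blocks fill at least half of the text.\<close>
  have "n = \<sigma> * k + n mod \<sigma>" by (simp add: k_def)
  moreover have "n mod \<sigma> < \<sigma>" using \<sigma>n by simp
  moreover have "\<sigma> \<le> \<sigma> * k" using k by simp
  ultimately have "n \<le> \<sigma> * k * 2" by linarith
  then have "\<sigma> ^ n \<le> \<sigma> ^ (\<sigma> * k * 2)" using \<sigma>n by (intro power_increasing) auto
  also have "\<dots> = ((\<sigma> ^ \<sigma>) ^ k)\<^sup>2" by (simp add: power_mult)
  also have "\<dots> \<le> (((fact \<sigma>)\<^sup>2) ^ k)\<^sup>2" by (intro power_mono power_self_le_fact_power2) auto
  also have "\<dots> = (fact \<sigma> ^ k) ^ 4"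
    by (simp only: power_mult[symmetric]) (simp add: mult.commute)
  also have "\<dots> \<le> (2 ^ Suc L) ^ 4" using N by (intro power_mono) auto
  also have "\<dots> = 2 ^ (Suc L * 4)" by (simp only: power_mult)
  also have "\<dots> \<le> 2 ^ (8 * L)" using \<open>L \<noteq> 0\<close> by (intro power_increasing) auto
  finally have "real (\<sigma> ^ n) \<le> real (2 ^ (8 * L))" by (simp only: of_nat_le_iff)
  then have "log 2 (real \<sigma> ^ n) \<le> log 2 (2 ^ (8 * L))"
    using \<sigma>n by (intro log_mono) auto
  then have "real n * log 2 (real \<sigma>) \<le> 8 * real L" using \<sigma>n by (simp add: log_nat_power)
  then show "1 / 8 * real n * log 2 (real \<sigma>) \<le> real (worst_case_space (texts \<sigma> n) enc)"
    by (simp add: L_def)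
qed simp

end
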